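(* Let $r\ge2$ and define the sequence $\{\alpha_k\}_{k\ge0}$ by $\alpha_0=1$ and $$\alpha_k=\begin{cases}(k+r)/r,&k\text{ even},\\ \big(1+\sqrt{1+4\alpha_{k-1}^2}\big)/2,&k\text{ odd}.\end{cases}$$ Let $\sigma_{k+1}=(\alpha_k-1)/\alpha_{k+1}$. Then $\alpha_k>0$ for all $k$, $\alpha_k=\Omega(k)$, $\lim_k\alpha_{k+1}/\alpha_k=1$, and $\alpha_{k+1}(\alpha_{k+1}-1)\le\alpha_k^2$ for all $k\ge0$. But if $r>2$, then $\lim_kk(1-\sigma_{k+1})$ does not exist: along the even indices $k'=2k$ and odd indices $k''=2k+1$, $$\lim_{k'\to\infty}k'(1-\sigma_{k'+1})=\frac{3r}{2},\qquad\lim_{k''\to\infty}k''(1-\sigma_{k''+1})=2+\frac r2.$$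
   Context: $\alpha_k=\Omega(k)$ means that there are constants $c>0$ and $k_0\ge1$ with $\alpha_k\ge ck$ for all $k\ge k_0$. *)

theory Defs
  imports Complex_Main
begin

text \<open>The case \<open>k = 0\<close> is even, and the clause \<open>\<alpha>\<^sub>0 = 1\<close> agrees with \<open>(k + r) / r\<close> there.\<close>

primrec alpha :: "real \<Rightarrow> nat \<Rightarrow> real" where
  "alpha r 0 = 1"
| "alpha r (Suc k) =
    (if even (Suc k) then (real (Suc k) + r) / r
     else (1 + sqrt (1 + 4 * (alpha r k)\<^sup>2)) / 2)"

text \<open>The sequence \<open>\<sigma>\<close> starts at index 1; the value at index 0 is left unspecified.\<close>

primrec sigma :: "real \<Rightarrow> nat \<Rightarrow> real" where
  "sigma r 0 = undefined"
| "sigma r (Suc k) = (alpha r k - 1) / alpha r (Suc k)"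

end

theory Submission
  imports Defs "HOL-Real_Asymp.Real_Asymp"
begin

text \<open>Every odd term exceeds the preceding even term \<open>x = 1 + 2k/r\<close> by \<open>1/2 + o(1)\<close>, while
  consecutive even terms differ by \<open>2/r\<close>. Hence the numerators of \<open>1 - \<sigma>\<close>, the increments plus 1,
  tend to \<open>3/2\<close> at even and to \<open>2/r + 1/2\<close> at odd indices, and \<open>k/\<alpha>\<^sub>k\<close> tends to \<open>r\<close>.
  The two limits \<open>3r/2\<close> and \<open>2 + r/2\<close> agree only for \<open>r = 2\<close>.\<close>

lemma alpha_even: "r > 0 \<Longrightarrow> alpha r (2 * k) = 1 + 2 * real k / r"
  by (cases k) (auto simp: field_simps)

lemma double_eq_alpha: "r > 0 \<Longrightarrow> real (2 * k) = r * (alpha r (2 * k) - 1)"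
  by (simp add: alpha_even)

lemma alpha_Suc_even: "alpha r (Suc (2 * k)) = (1 + sqrt (1 + 4 * (alpha r (2 * k))\<^sup>2)) / 2"
  by simp

lemma alpha_Suc_odd:
  assumes "r > 0"
  shows "alpha r (Suc (Suc (2 * k))) = alpha r (2 * k) + 2 / r"
  using alpha_even[OF assms, of "Suc k"] alpha_even[OF assms, of k]
  by (simp add: add_divide_distrib del: alpha.simps)

lemma alpha_even_ge_1: "r > 0 \<Longrightarrow> alpha r (2 * k) \<ge> 1"
  by (simp add: alpha_even)

lemma alpha_odd_ge: "alpha r (Suc (2 * k)) \<ge> alpha r (2 * k) + 1 / 2"
proof -
  have "2 * alpha r (2 * k) \<le> sqrt (1 + 4 * (alpha r (2 * k))\<^sup>2)"
    by (rule real_le_rsqrt) (simp add: power2_eq_square)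
  then show ?thesis by simp
qed

lemma alpha_ge_linear:
  assumes "r \<ge> 2"
  shows "alpha r k \<ge> 1 + real k / r"
proof (cases "even k")
  case True
  then show ?thesis using assms by (auto elim!: evenE simp: alpha_even)
next
  case False
  then obtain m where m: "k = Suc (2 * m)" by (auto elim: oddE)
  have "1 / r \<le> 1 / 2" using assms by (simp add: field_simps)
  then show ?thesis
    using alpha_odd_ge[of r m] alpha_even[of r m] assms
    unfolding m of_nat_Suc add_divide_distrib of_nat_mult of_nat_numeral by linarith
qed

lemma alpha_pos: "r \<ge> 2 \<Longrightarrow> alpha r k > 0"
  using alpha_ge_linear[of r k] by (smt (verit) divide_nonneg_nonneg of_nat_0_le_iff)

lemma alpha_recursion_le:
  assumes "r \<ge> 2"
  shows "alpha r (Suc k) * (alpha r (Suc k) - 1) \<le> (alpha r k)\<^sup>2"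
proof (cases "even k")
  case True
  define s where "s = sqrt (1 + 4 * (alpha r k)\<^sup>2)"
  have "s\<^sup>2 = 1 + 4 * (alpha r k)\<^sup>2" by (simp add: s_def)
  moreover have c: "alpha r (Suc k) = (1 + s) / 2" using True by (simp add: s_def)
  ultimately show ?thesis unfolding c by (simp add: power2_eq_square field_simps)
next
  case False
  then obtain m where m: "k = Suc (2 * m)" by (auto elim: oddE)
  define a b c where "a = alpha r (2 * m)" and "b = alpha r k" and "c = alpha r (Suc k)"
  have a: "a \<ge> 1" and b: "b \<ge> a + 1 / 2"
    using assms alpha_even_ge_1[of r m] alpha_odd_ge[of r m] by (simp_all add: a_def b_def m del: alpha.simps)
  have "c = a + 2 / r"
    using alpha_Suc_odd[of r m] assms by (simp add: a_def c_def m del: alpha.simps)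
  then have c: "1 \<le> c" "c \<le> a + 1" using a assms by (auto simp: add_increasing2)
  have "c * (c - 1) \<le> (a + 1) * a" using a c by (intro mult_mono) auto
  also have "\<dots> \<le> (a + 1 / 2)\<^sup>2" by (simp add: power2_eq_square algebra_simps)
  also have "\<dots> \<le> b\<^sup>2" using a b by (intro power_mono) auto
  finally show ?thesis by (simp add: b_def c_def del: alpha.simps)
qed

lemma LIMSEQ_even_odd:
  fixes f :: "nat \<Rightarrow> 'a :: topological_space"
  assumes "(\<lambda>k. f (2 * k)) \<longlonglongrightarrow> L" "(\<lambda>k. f (Suc (2 * k))) \<longlonglongrightarrow> L"
  shows "f \<longlonglongrightarrow> L"
proof (rule topological_tendstoI)
  fix S assume S: "open S" "L \<in> S"
  obtain M N where M: "\<And>k. k \<ge> M \<Longrightarrow> f (2 * k) \<in> S" and N: "\<And>k. k \<ge> N \<Longrightarrow> f (Suc (2 * k)) \<in> S"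
    using topological_tendstoD[OF assms(1) S] topological_tendstoD[OF assms(2) S]
    unfolding eventually_sequentially by blast
  have "f n \<in> S" if "n \<ge> 2 * M + 2 * N + 1" for n
    using that M[of "n div 2"] N[of "n div 2"] by (cases "even n") auto
  then show "\<forall>\<^sub>F n in sequentially. f n \<in> S"
    unfolding eventually_sequentially by blast
qed

lemma alpha_even_at_top:
  assumes "r > 0"
  shows "filterlim (\<lambda>k. alpha r (2 * k)) at_top sequentially"
  unfolding alpha_even[OF assms] using assms by real_asymp

text \<open>The limits are taken in the variable \<open>x = \<alpha>\<^bsub>2k\<^esub>\<close>, so that \<open>2k = r (x - 1)\<close> and the
  argument of the square root does not involve \<open>r\<close>.\<close>

lemma alpha_ratio_tendsto:
  assumes "r > 0"
  shows "(\<lambda>k. alpha r (Suc k) / alpha r k) \<longlonglongrightarrow> 1"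
proof (rule LIMSEQ_even_odd)
  have "((\<lambda>x::real. (1 + sqrt (1 + 4 * x\<^sup>2)) / 2 / x) \<longlongrightarrow> 1) at_top"
    by real_asymp
  from filterlim_compose[OF this alpha_even_at_top[OF assms]]
  show "(\<lambda>k. alpha r (Suc (2 * k)) / alpha r (2 * k)) \<longlonglongrightarrow> 1"
    by simp
  have "((\<lambda>x::real. (x + 2 / r) / ((1 + sqrt (1 + 4 * x\<^sup>2)) / 2)) \<longlongrightarrow> 1) at_top"
    by real_asymp
  from filterlim_compose[OF this alpha_even_at_top[OF assms]]
  show "(\<lambda>k. alpha r (Suc (Suc (2 * k))) / alpha r (Suc (2 * k))) \<longlonglongrightarrow> 1"
    by (simp only: alpha_Suc_odd[OF assms] alpha_Suc_even)
qed

lemma sigma_limit_even: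
  assumes "r > 0"
  shows "(\<lambda>k. real (2 * k) * (1 - sigma r (Suc (2 * k)))) \<longlonglongrightarrow> 3 * r / 2"
proof -
  have "((\<lambda>x. r * (x - 1) * (1 - (x - 1) / ((1 + sqrt (1 + 4 * x\<^sup>2)) / 2))) \<longlongrightarrow> 3 * r / 2) at_top"
    using assms by real_asymp
  from filterlim_compose[OF this alpha_even_at_top[OF assms]] show ?thesis
    by (simp only: sigma.simps alpha_Suc_even double_eq_alpha[OF assms])
qed

lemma sigma_limit_odd:
  assumes "r > 0"
  shows "(\<lambda>k. real (Suc (2 * k)) * (1 - sigma r (Suc (Suc (2 * k))))) \<longlonglongrightarrow> 2 + r / 2"
proof -
  have "((\<lambda>x. (1 + r * (x - 1)) * (1 - ((1 + sqrt (1 + 4 * x\<^sup>2)) / 2 - 1) / (x + 2 / r)))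
      \<longlongrightarrow> 2 + r / 2) at_top"
    using assms by (real_asymp simp: field_simps)
  from filterlim_compose[OF this alpha_even_at_top[OF assms]] show ?thesis
    by (simp only: sigma.simps alpha_Suc_odd[OF assms] alpha_Suc_even of_nat_Suc double_eq_alpha[OF assms])
qed

theorem lemma1:
  fixes r :: real
  assumes "r \<ge> 2"
  shows "(\<forall>k. alpha r k > 0)
    \<and> (\<exists>c>0. \<exists>k0\<ge>1. \<forall>k\<ge>k0. alpha r k \<ge> c * real k)
    \<and> (\<lambda>k. alpha r (k + 1) / alpha r k) \<longlonglongrightarrow> 1
    \<and> (\<forall>k. alpha r (k + 1) * (alpha r (k + 1) - 1) \<le> (alpha r k)\<^sup>2)
    \<and> (r > 2 \<longrightarrow>
        \<not> convergent (\<lambda>k. real k * (1 - sigma r (k + 1)))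
        \<and> (\<lambda>k. real (2 * k) * (1 - sigma r (2 * k + 1))) \<longlonglongrightarrow> 3 * r / 2
        \<and> (\<lambda>k. real (2 * k + 1) * (1 - sigma r (2 * k + 1 + 1))) \<longlonglongrightarrow> 2 + r / 2)"
proof (intro conjI impI)
  have r: "r > 0" using assms by simp
  show "\<forall>k. alpha r k > 0" using alpha_pos[OF assms] by blast
  have "alpha r k \<ge> 1 / r * real k" for k using alpha_ge_linear[OF assms, of k] by simp
  then show "\<exists>c>0. \<exists>k0\<ge>1. \<forall>k\<ge>k0. alpha r k \<ge> c * real k"
    using r by (intro exI[of _ "1 / r"] conjI exI[of _ "1::nat"]) auto
  show "(\<lambda>k. alpha r (k + 1) / alpha r k) \<longlonglongrightarrow> 1"
    using alpha_ratio_tendsto[OF r] by (simp del: alpha.simps)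
  show "\<forall>k. alpha r (k + 1) * (alpha r (k + 1) - 1) \<le> (alpha r k)\<^sup>2"
    using alpha_recursion_le[OF assms] by (simp del: alpha.simps)
  show even: "(\<lambda>k. real (2 * k) * (1 - sigma r (2 * k + 1))) \<longlonglongrightarrow> 3 * r / 2"
    using sigma_limit_even[OF r] by (simp del: sigma.simps)
  show odd: "(\<lambda>k. real (2 * k + 1) * (1 - sigma r (2 * k + 1 + 1))) \<longlonglongrightarrow> 2 + r / 2"
    using sigma_limit_odd[OF r] by (simp del: sigma.simps)
  assume "r > 2"
  show "\<not> convergent (\<lambda>k. real k * (1 - sigma r (k + 1)))"
  proof
    let ?f = "\<lambda>k. real k * (1 - sigma r (k + 1))"
    assume "convergent ?f"
    then obtain L where L: "?f \<longlonglongrightarrow> L" by (auto simp: convergent_def)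
    have "(\<lambda>k. ?f (2 * k)) \<longlonglongrightarrow> L" "(\<lambda>k. ?f (2 * k + 1)) \<longlonglongrightarrow> L"
      using LIMSEQ_subseq_LIMSEQ[OF L, of "\<lambda>k. 2 * k"] LIMSEQ_subseq_LIMSEQ[OF L, of "\<lambda>k. 2 * k + 1"]
      by (simp_all add: strict_mono_def o_def del: sigma.simps)
    then have "3 * r / 2 = L" "2 + r / 2 = L"
      using even odd LIMSEQ_unique by blast+
    then show False using \<open>r > 2\<close> by simp
  qed
qed

end
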